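(* Let $\mathcal{R}$ be a unital ring with involution, let $m\in\mathcal{R}$ be invertible with $m^*=m$, and let $a,b\in\mathcal{R}^{\mathrm{core},m}$. If $a^2=ba$, then: (i) $ab\in\mathcal{R}^{\mathrm{core},m}$ and $(ab)^{\mathrm{core},m}=b^{\mathrm{core},m}a^{\mathrm{core},m}$; (ii) $ab\,b^{\mathrm{core},m}\in\mathcal{R}^{\mathrm{core},m}$ and $\left(ab\,b^{\mathrm{core},m}\right)^{\mathrm{core},m}=b\,b^{\mathrm{core},m}a^{\mathrm{core},m}$.
   Context: $\mathcal{R}$ is a (not necessarily commutative) unital ring with an involution $x\mapsto x^*$ satisfying $(xy)^*=y^*x^*$, $(x+y)^*=x^*+y^*$, $(x^* )^*=x$. For an invertible $m\in\mathcal{R}$ with $m^*=m$, an element $z\in\mathcal{R}$ is the $m$-weighted core inverse of $a\in\mathcal{R}$ if $aza=a$, $z\mathcal{R}=a\mathcal{R}$ and $\mathcal{R}z=\mathcal{R}a^*m$. It is unique if it exists and is denoted $a^{\mathrm{core},m}$; $\mathcal{R}^{\mathrm{core},m}$ is the set of elements that have an $m$-weighted core inverse. *)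

theory Defs
  imports "HOL-Algebra.AbelCoset"
begin

text \<open>
  The locale \<^locale>\<open>ring\<close> is that of unital, not necessarily commutative rings; the zero ring
  is included. The involution is a map that is only constrained on the carrier.
\<close>

locale ring_with_involution = ring R for R (structure) +
  fixes star :: "'a \<Rightarrow> 'a"
  assumes star_closed: "x \<in> carrier R \<Longrightarrow> star x \<in> carrier R"
    and star_mult: "\<lbrakk>x \<in> carrier R; y \<in> carrier R\<rbrakk> \<Longrightarrow> star (x \<otimes> y) = star y \<otimes> star x"
    and star_add: "\<lbrakk>x \<in> carrier R; y \<in> carrier R\<rbrakk> \<Longrightarrow> star (x \<oplus> y) = star x \<oplus> star y"
    and star_star: "x \<in> carrier R \<Longrightarrow> star (star x) = x"

text \<open>
  The multiplicative cosets \<open>z <#\<^bsub>R\<^esub> carrier R\<close> and \<open>carrier R #>\<^bsub>R\<^esub> z\<close> are the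
  principal one-sided ideals \<open>zR\<close> and \<open>Rz\<close>.
\<close>

definition is_weighted_core_inverse ::
    "('a, 'b) ring_scheme \<Rightarrow> ('a \<Rightarrow> 'a) \<Rightarrow> 'a \<Rightarrow> 'a \<Rightarrow> 'a \<Rightarrow> bool" where
  "is_weighted_core_inverse R star m a z \<longleftrightarrow>
     z \<in> carrier R \<and>
     a \<otimes>\<^bsub>R\<^esub> z \<otimes>\<^bsub>R\<^esub> a = a \<and>
     z <#\<^bsub>R\<^esub> carrier R = a <#\<^bsub>R\<^esub> carrier R \<and>
     carrier R #>\<^bsub>R\<^esub> z = carrier R #>\<^bsub>R\<^esub> (star a \<otimes>\<^bsub>R\<^esub> m)"

definition weighted_core_invertible ::
    "('a, 'b) ring_scheme \<Rightarrow> ('a \<Rightarrow> 'a) \<Rightarrow> 'a \<Rightarrow> 'a set" where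
  "weighted_core_invertible R star m =
     {a \<in> carrier R. \<exists>z. is_weighted_core_inverse R star m a z}"

text \<open>
  Unspecified outside \<^const>\<open>weighted_core_invertible\<close>; on that set it is determined by the
  uniqueness lemma below.
\<close>

definition weighted_core_inverse ::
    "('a, 'b) ring_scheme \<Rightarrow> ('a \<Rightarrow> 'a) \<Rightarrow> 'a \<Rightarrow> 'a \<Rightarrow> 'a" where
  "weighted_core_inverse R star m a = (THE z. is_weighted_core_inverse R star m a z)"

lemma (in ring_with_involution) weighted_core_inverse_props:
  assumes m: "m \<in> Units R" "star m = m" and a: "a \<in> carrier R"
    and z: "is_weighted_core_inverse R star m a z"
  shows "star (m \<otimes> (a \<otimes> z)) = m \<otimes> (a \<otimes> z)" "z \<otimes> a \<otimes> z = z" "a \<otimes> z \<otimes> z = z" "z \<otimes> a \<otimes> a = a"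
    "\<exists>q\<in>carrier R. z = a \<otimes> q"
proof -
  have zc: "z \<in> carrier R" and aza: "a \<otimes> z \<otimes> a = a"
    and r: "z <# carrier R = a <# carrier R" and l: "carrier R #> z = carrier R #> (star a \<otimes> m)"
    using z by (auto simp: is_weighted_core_inverse_def)
  have mc: "m \<in> carrier R" using m by blast
  note c = zc a mc star_closed
  have "z \<in> z <# carrier R" "a \<in> a <# carrier R"
    using zc a by (auto simp: l_coset_def intro: bexI[of _ \<one>])
  then have "a \<in> z <# carrier R" "z \<in> a <# carrier R"
    unfolding r by auto
  then obtain p q where p: "p \<in> carrier R" "a = z \<otimes> p" and q: "q \<in> carrier R" "z = a \<otimes> q"
    unfolding l_coset_def by blast
  have "z \<in> carrier R #> z" "star a \<otimes> m \<in> carrier R #> (star a \<otimes> m)"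
    using c by (auto simp: r_coset_def intro: bexI[of _ \<one>])
  then have "z \<in> carrier R #> (star a \<otimes> m)"
    unfolding l by auto
  then obtain t where t: "t \<in> carrier R" "z = t \<otimes> (star a \<otimes> m)"
    unfolding r_coset_def by blast
  show azz: "a \<otimes> z \<otimes> z = z"
  proof -
    have "a \<otimes> z \<otimes> (a \<otimes> q) = a \<otimes> z \<otimes> a \<otimes> q"
      using q(1) zc a by (simp add: m_assoc)
    then show ?thesis using aza q(2) by simp
  qed
  define e where "e = a \<otimes> z"
  have ec: "e \<in> carrier R" and ea: "e \<otimes> a = a" using c aza by (auto simp: e_def)
  define n where "n = inv m"
  have n: "n \<in> carrier R" "n \<otimes> m = \<one>" "m \<otimes> n = \<one>" using m(1) by (auto simp: n_def)
  have sa: "star a \<otimes> star e = star a" using star_mult[OF ec a] ea by simp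
  have zn: "z \<otimes> n = t \<otimes> star a"
    using t n mc a star_closed by (simp add: m_assoc)
  have "z \<otimes> n \<otimes> star e = z \<otimes> n"
    using zn sa t(1) ec a star_closed by (simp add: m_assoc)
  then have en: "e \<otimes> n \<otimes> star e = e \<otimes> n"
    using ec n c by (simp add: e_def m_assoc)
  have one: "star \<one> = \<one>"
    using star_mult[of "star \<one>" \<one>] star_star[of \<one>] star_closed[of \<one>] by simp
  have "star n \<otimes> m = \<one>"
    using star_mult[OF mc n(1)] n(3) m(2) one by simp
  then have sn: "star n = n"
    using inv_unique[of "star n" m n] n mc star_closed by simp
  have "star (e \<otimes> n) = star (e \<otimes> n \<otimes> star e)" using en by simp
  also have "\<dots> = e \<otimes> n \<otimes> star e"
    using ec n sn star_closed by (simp add: star_mult star_star m_assoc)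
  finally have sen: "n \<otimes> star e = e \<otimes> n"
    using en ec n sn by (simp add: star_mult)
  have "m \<otimes> (n \<otimes> star e) \<otimes> m = m \<otimes> (e \<otimes> n) \<otimes> m" by (simp add: sen)
  moreover have "m \<otimes> (n \<otimes> star e) \<otimes> m = star e \<otimes> m"
    using n mc ec star_closed by (simp flip: m_assoc)
  moreover have "m \<otimes> (e \<otimes> n) \<otimes> m = m \<otimes> e"
    using n mc ec by (simp add: m_assoc)
  ultimately have me: "star e \<otimes> m = m \<otimes> e" by simp
  then show "star (m \<otimes> (a \<otimes> z)) = m \<otimes> (a \<otimes> z)"
    using m(2) mc ec by (simp add: star_mult flip: e_def)
  have "star a \<otimes> m \<otimes> e = star a \<otimes> m"
  proof -
    have "star a \<otimes> m \<otimes> e = star a \<otimes> star e \<otimes> m"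
      using me mc ec a star_closed by (simp add: m_assoc)
    then show ?thesis using sa by simp
  qed
  then have "z \<otimes> e = z"
    using t ec mc a star_closed by (simp add: m_assoc)
  then show zaz: "z \<otimes> a \<otimes> z = z" using c by (simp add: e_def m_assoc)
  show "z \<otimes> a \<otimes> a = a"
  proof -
    have "z \<otimes> a \<otimes> (z \<otimes> p) = z \<otimes> a \<otimes> z \<otimes> p"
      using p(1) zc a by (simp add: m_assoc)
    then show ?thesis using zaz p(2) by simp
  qed
  show "\<exists>q\<in>carrier R. z = a \<otimes> q" using q by blast
qed

lemma (in ring_with_involution) is_weighted_core_inverse_unique:
  assumes m: "m \<in> Units R" "star m = m" and a: "a \<in> carrier R"
    and z: "is_weighted_core_inverse R star m a z" and w: "is_weighted_core_inverse R star m a w"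
  shows "z = w"
proof -
  note Z = weighted_core_inverse_props[OF m a z] and W = weighted_core_inverse_props[OF m a w]
  have mc: "m \<in> carrier R" using m by blast
  have zc: "z \<in> carrier R" "a \<otimes> z \<otimes> a = a" and wc: "w \<in> carrier R" "a \<otimes> w \<otimes> a = a"
    using z w by (auto simp: is_weighted_core_inverse_def)
  define e f where "e = a \<otimes> z" and "f = a \<otimes> w"
  have ef: "e \<in> carrier R" "f \<in> carrier R" using zc wc a by (auto simp: e_def f_def)
  have fe: "f \<otimes> e = e" "e \<otimes> f = f"
    using zc wc a by (simp_all add: e_def f_def flip: m_assoc)
  have se: "star e \<otimes> m = m \<otimes> e" and sf: "star f \<otimes> m = m \<otimes> f"
    using Z(1) W(1) m mc ef by (simp_all add: star_mult flip: e_def f_def)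
  have "m \<otimes> e = star (f \<otimes> e) \<otimes> m" using se fe by simp
  also have "\<dots> = star e \<otimes> (star f \<otimes> m)" using ef mc star_closed by (simp add: star_mult m_assoc)
  also have "\<dots> = star e \<otimes> m \<otimes> f" using sf ef mc star_closed by (simp add: m_assoc)
  also have "\<dots> = m \<otimes> f" using se fe ef mc by (simp add: m_assoc)
  finally have "e = f" using m(1) ef by (simp add: Units_l_cancel)
  obtain q where q: "q \<in> carrier R" "w = a \<otimes> q" using W(5) by blast
  have "z = z \<otimes> a \<otimes> w"
    using Z(2) \<open>e = f\<close> zc wc a by (simp add: e_def f_def m_assoc)
  also have "\<dots> = w"
  proof -
    have "z \<otimes> a \<otimes> (a \<otimes> q) = z \<otimes> a \<otimes> a \<otimes> q"
      using q(1) zc a by (simp add: m_assoc)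
    then show ?thesis using Z(4) q(2) by simp
  qed
  finally show ?thesis .
qed

end

theory Submission
  imports Defs
begin

text \<open>
  Let \<open>z\<close> and \<open>w\<close> be the weighted core inverses of \<open>a\<close> and \<open>b\<close>. Since \<open>z = az\<^sup>2\<close>, multiplying
  \<open>a\<^sup>2 = ba\<close> by \<open>z\<^sup>2\<close> on the right gives \<open>az = bz\<close>: thus \<open>a\<close> and \<open>b\<close> agree on \<open>aR = zR\<close>, and
  this ideal lies in \<open>bR\<close>. As \<open>bw\<close> is a left identity on \<open>bR\<close>, it fixes \<open>a\<close> and \<open>z\<close>, and
  \<open>w\<close>, which inverts \<open>b\<close> on \<open>bR\<close>, acts on \<open>aR\<close> as \<open>z\<close> does. So the two products in the
  theorem collapse, \<open>wz = z\<^sup>2\<close> and \<open>bwz = z\<close>, and \<open>(ab)(wz) = az = (abw)z\<close>.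
  Both claims are therefore about one Hermitian element, \<open>maz\<close>, and what remains is to recognise a
  weighted core inverse from three equations that can be checked by cancellation: this is the
  lemma \<open>is_weighted_core_inverseI\<close> below.
\<close>

context ring_with_involution
begin

text \<open>
  The equations say that \<open>x\<close> inverts \<open>c\<close> on \<open>cR = xR\<close> and that \<open>cx\<close> is self-adjoint for the form
  given by \<open>m\<close>. They already imply that \<open>x\<close> is a reflexive inverse of \<open>c\<close>: for instance
  \<open>cxc = cx(xcc) = (cxx)cc = xcc = c\<close>. The right ideals then agree by the first two
  equations, and self-adjointness turns \<open>x = xcx\<close> and \<open>c = cxc\<close> into equality of the left ideals.
\<close>

lemma is_weighted_core_inverseI:
  assumes m: "m \<in> Units R" "star m = m" and c: "c \<in> carrier R" and x: "x \<in> carrier R"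
    and cxx: "c \<otimes> x \<otimes> x = x" and xcc: "x \<otimes> c \<otimes> c = c"
    and herm: "star (m \<otimes> (c \<otimes> x)) = m \<otimes> (c \<otimes> x)"
  shows "is_weighted_core_inverse R star m c x"
proof -
  have mc: "m \<in> carrier R" using m by blast
  note cl = c x mc star_closed
  have cxc: "c \<otimes> x \<otimes> c = c"
  proof -
    have "c \<otimes> x \<otimes> c = c \<otimes> x \<otimes> (x \<otimes> c \<otimes> c)" by (simp only: xcc)
    also have "\<dots> = (c \<otimes> x \<otimes> x) \<otimes> c \<otimes> c" using c x by (simp add: m_assoc)
    finally show ?thesis by (simp only: cxx xcc)
  qed
  have xcx: "x \<otimes> c \<otimes> x = x"
  proof -
    have "x \<otimes> c \<otimes> x = x \<otimes> c \<otimes> (c \<otimes> x \<otimes> x)" by (simp only: cxx)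
    also have "\<dots> = (x \<otimes> c \<otimes> c) \<otimes> x \<otimes> x" using c x by (simp add: m_assoc)
    finally show ?thesis by (simp only: cxx xcc)
  qed
  have adj: "star (c \<otimes> x) \<otimes> m = m \<otimes> (c \<otimes> x)"
    using herm m(2) mc c x by (simp add: star_mult)
  have right: "x <# carrier R = c <# carrier R"
  proof -
    have "\<exists>s\<in>carrier R. x \<otimes> r = c \<otimes> s" if "r \<in> carrier R" for r
    proof -
      have "x \<otimes> r = c \<otimes> x \<otimes> x \<otimes> r" by (simp only: cxx)
      also have "\<dots> = c \<otimes> (x \<otimes> x \<otimes> r)" using c x that by (simp add: m_assoc)
      finally show ?thesis using x that by blast
    qed
    moreover have "\<exists>s\<in>carrier R. c \<otimes> r = x \<otimes> s" if "r \<in> carrier R" for r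
    proof -
      have "c \<otimes> r = x \<otimes> c \<otimes> c \<otimes> r" by (simp only: xcc)
      also have "\<dots> = x \<otimes> (c \<otimes> c \<otimes> r)" using c x that by (simp add: m_assoc)
      finally show ?thesis using c that by blast
    qed
    ultimately show ?thesis unfolding l_coset_def by blast
  qed
  have sc: "star c \<otimes> m = star c \<otimes> m \<otimes> c \<otimes> x"
  proof -
    have "star c \<otimes> m = star (c \<otimes> x \<otimes> c) \<otimes> m" by (simp only: cxc)
    also have "\<dots> = star c \<otimes> (star (c \<otimes> x) \<otimes> m)"
      using star_mult[of "c \<otimes> x" c] cl by (simp only: m_closed m_assoc[of "star c"])
    also have "\<dots> = star c \<otimes> m \<otimes> c \<otimes> x" using cl by (simp add: adj m_assoc)
    finally show ?thesis .
  qed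
  have xs: "x = x \<otimes> inv m \<otimes> star x \<otimes> (star c \<otimes> m)"
  proof -
    have "x = x \<otimes> inv m \<otimes> (m \<otimes> (c \<otimes> x))"
    proof -
      have "x \<otimes> inv m \<otimes> (m \<otimes> (c \<otimes> x)) = x \<otimes> (inv m \<otimes> m) \<otimes> (c \<otimes> x)"
        using cl m(1) by (simp only: m_assoc Units_inv_closed m_closed)
      also have "\<dots> = x \<otimes> c \<otimes> x" using cl m(1) by (simp add: m_assoc)
      finally show ?thesis by (simp only: xcx)
    qed
    also have "\<dots> = x \<otimes> inv m \<otimes> (star (c \<otimes> x) \<otimes> m)" by (simp only: adj)
    also have "\<dots> = x \<otimes> inv m \<otimes> star x \<otimes> (star c \<otimes> m)"
      using cl m(1) by (simp add: star_mult m_assoc)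
    finally show ?thesis .
  qed
  have left: "carrier R #> x = carrier R #> (star c \<otimes> m)"
  proof -
    have "\<exists>s\<in>carrier R. r \<otimes> x = s \<otimes> (star c \<otimes> m)" if "r \<in> carrier R" for r
    proof
      have "r \<otimes> x = r \<otimes> (x \<otimes> inv m \<otimes> star x \<otimes> (star c \<otimes> m))" by (simp only: xs[symmetric])
      then show "r \<otimes> x = r \<otimes> (x \<otimes> inv m \<otimes> star x) \<otimes> (star c \<otimes> m)"
        using cl m(1) that by (simp add: m_assoc)
      show "r \<otimes> (x \<otimes> inv m \<otimes> star x) \<in> carrier R" using cl m(1) that by simp
    qed
    moreover have "\<exists>s\<in>carrier R. r \<otimes> (star c \<otimes> m) = s \<otimes> x" if "r \<in> carrier R" for r
    proof
      have "r \<otimes> (star c \<otimes> m) = r \<otimes> (star c \<otimes> m \<otimes> c \<otimes> x)" by (simp only: sc[symmetric])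
      then show "r \<otimes> (star c \<otimes> m) = r \<otimes> (star c \<otimes> m \<otimes> c) \<otimes> x"
        using cl that by (simp add: m_assoc)
      show "r \<otimes> (star c \<otimes> m \<otimes> c) \<in> carrier R" using cl that by simp
    qed
    ultimately show ?thesis unfolding r_coset_def by blast
  qed
  show ?thesis unfolding is_weighted_core_inverse_def using x cxc right left by blast
qed

lemma weighted_core_inverse_eqI:
  assumes "m \<in> Units R" "star m = m" "c \<in> carrier R" "is_weighted_core_inverse R star m c x"
  shows "c \<in> weighted_core_invertible R star m" "weighted_core_inverse R star m c = x"
  using assms is_weighted_core_inverse_unique[OF assms(1-3)]
  by (auto simp: weighted_core_invertible_def weighted_core_inverse_def intro!: the_equality)

lemma is_weighted_core_inverse_weighted_core_inverse:
  assumes "m \<in> Units R" "star m = m" "c \<in> weighted_core_invertible R star m"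
  shows "is_weighted_core_inverse R star m c (weighted_core_inverse R star m c)"
  using assms weighted_core_inverse_eqI(2) by (fastforce simp: weighted_core_invertible_def)

context
  fixes m a b z w
  assumes m: "m \<in> Units R" "star m = m"
    and a: "a \<in> carrier R" and b: "b \<in> carrier R"
    and z: "is_weighted_core_inverse R star m a z"
    and w: "is_weighted_core_inverse R star m b w"
    and aa: "a \<otimes> a = b \<otimes> a"
begin

lemma inverses_closed: "z \<in> carrier R" "w \<in> carrier R"
  using z w by (auto simp: is_weighted_core_inverse_def)

lemmas closed = a b inverses_closed
lemmas z_props = weighted_core_inverse_props[OF m a z]
lemmas w_props = weighted_core_inverse_props[OF m b w]

lemma mult_core_inverse_agree: "b \<otimes> z = a \<otimes> z"
proof -
  have "b \<otimes> z = b \<otimes> (a \<otimes> z \<otimes> z)" by (simp only: z_props)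
  also have "\<dots> = (b \<otimes> a) \<otimes> z \<otimes> z" using closed by (simp add: m_assoc)
  also have "\<dots> = a \<otimes> (a \<otimes> z \<otimes> z)" unfolding aa[symmetric] using closed by (simp add: m_assoc)
  finally show ?thesis by (simp only: z_props)
qed

lemma b_z_z: "b \<otimes> z \<otimes> z = z"
  by (simp only: mult_core_inverse_agree z_props)

lemma projection_fixes_z: "b \<otimes> w \<otimes> z = z"
proof -
  have "b \<otimes> w \<otimes> b = b" using w by (simp add: is_weighted_core_inverse_def)
  moreover have "b \<otimes> w \<otimes> (b \<otimes> z \<otimes> z) = (b \<otimes> w \<otimes> b) \<otimes> z \<otimes> z"
    using closed by (simp add: m_assoc)
  ultimately show ?thesis by (simp only: b_z_z)
qed

lemma projection_fixes_a: "b \<otimes> w \<otimes> a = a"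
proof -
  have "b \<otimes> w \<otimes> (z \<otimes> a \<otimes> a) = (b \<otimes> w \<otimes> z) \<otimes> a \<otimes> a"
    using closed by (simp add: m_assoc)
  then show ?thesis by (simp only: projection_fixes_z z_props)
qed

text \<open>
  Writing \<open>z = bz\<^sup>2 = b\<^sup>2z\<^sup>3\<close> exposes a factor \<open>b\<^sup>2\<close>, from which \<open>w\<close> cancels one \<open>b\<close>.
\<close>

lemma product_of_inverses: "w \<otimes> z = z \<otimes> z"
proof -
  have "w \<otimes> z = w \<otimes> (b \<otimes> (b \<otimes> z \<otimes> z) \<otimes> z)" by (simp only: b_z_z)
  also have "\<dots> = (w \<otimes> b \<otimes> b) \<otimes> z \<otimes> z \<otimes> z" using closed by (simp add: m_assoc)
  also have "\<dots> = z \<otimes> z" by (simp only: w_props b_z_z)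
  finally show ?thesis .
qed

text \<open>
  Because \<open>aba = a\<^sup>3\<close>, the square of \<open>ab\<close> is \<open>a\<^sup>3b\<close>, and \<open>z\<^sup>2\<close> cancels two of its factors \<open>a\<close>.
\<close>

lemma core_inverse_mult: "is_weighted_core_inverse R star m (a \<otimes> b) (w \<otimes> z)"
proof -
  have proj: "a \<otimes> b \<otimes> (w \<otimes> z) = a \<otimes> z"
  proof -
    have "a \<otimes> b \<otimes> (w \<otimes> z) = a \<otimes> (b \<otimes> w \<otimes> z)" using closed by (simp add: m_assoc)
    then show ?thesis by (simp only: projection_fixes_z)
  qed
  show ?thesis
  proof (rule is_weighted_core_inverseI[OF m])
    show "a \<otimes> b \<otimes> (w \<otimes> z) \<otimes> (w \<otimes> z) = w \<otimes> z"
    proof -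
      have "a \<otimes> z \<otimes> (z \<otimes> z) = (a \<otimes> z \<otimes> z) \<otimes> z" using closed by (simp add: m_assoc)
      then show ?thesis unfolding proj by (simp only: product_of_inverses z_props)
    qed
    show "w \<otimes> z \<otimes> (a \<otimes> b) \<otimes> (a \<otimes> b) = a \<otimes> b"
    proof -
      have "z \<otimes> z \<otimes> (a \<otimes> b) \<otimes> (a \<otimes> b) = z \<otimes> z \<otimes> a \<otimes> (b \<otimes> a) \<otimes> b"
        using closed by (simp add: m_assoc)
      also have "\<dots> = z \<otimes> (z \<otimes> a \<otimes> a) \<otimes> a \<otimes> b"
        unfolding aa[symmetric] using closed by (simp add: m_assoc)
      finally show ?thesis by (simp only: product_of_inverses z_props)
    qed
  qed (use closed z_props(1) in \<open>simp_all add: proj\<close>)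
qed

lemma core_inverse_mult_projection:
  "is_weighted_core_inverse R star m (a \<otimes> b \<otimes> w) (b \<otimes> w \<otimes> z)"
proof -
  have proj: "a \<otimes> b \<otimes> w \<otimes> z = a \<otimes> z"
  proof -
    have "a \<otimes> b \<otimes> w \<otimes> z = a \<otimes> (b \<otimes> w \<otimes> z)" using closed by (simp add: m_assoc)
    then show ?thesis by (simp only: projection_fixes_z)
  qed
  show ?thesis unfolding projection_fixes_z
  proof (rule is_weighted_core_inverseI[OF m])
    show "a \<otimes> b \<otimes> w \<otimes> z \<otimes> z = z" by (simp only: proj z_props)
    show "z \<otimes> (a \<otimes> b \<otimes> w) \<otimes> (a \<otimes> b \<otimes> w) = a \<otimes> b \<otimes> w"
    proof -
      have "z \<otimes> (a \<otimes> b \<otimes> w) \<otimes> (a \<otimes> b \<otimes> w) = z \<otimes> a \<otimes> (b \<otimes> w \<otimes> a) \<otimes> b \<otimes> w"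
        using closed by (simp add: m_assoc)
      then show ?thesis by (simp only: projection_fixes_a z_props)
    qed
  qed (use closed z_props(1) in \<open>simp_all add: proj\<close>)
qed

end

end

theorem theorem4p8:
  fixes R :: "('a, 'r) ring_scheme" (structure)
    and star :: "'a \<Rightarrow> 'a"
    and m a b :: 'a
  assumes "ring_with_involution R star"
    and "m \<in> Units R" and "star m = m"
    and "a \<in> weighted_core_invertible R star m"
    and "b \<in> weighted_core_invertible R star m"
    and "a \<otimes> a = b \<otimes> a"
  shows "(a \<otimes> b \<in> weighted_core_invertible R star m \<and>
          weighted_core_inverse R star m (a \<otimes> b)
            = weighted_core_inverse R star m b \<otimes> weighted_core_inverse R star m a) \<and>
         (a \<otimes> b \<otimes> weighted_core_inverse R star m b \<in> weighted_core_invertible R star m \<and>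
          weighted_core_inverse R star m (a \<otimes> b \<otimes> weighted_core_inverse R star m b)
            = b \<otimes> weighted_core_inverse R star m b \<otimes> weighted_core_inverse R star m a)"
proof -
  interpret ring_with_involution R star by fact
  note m = assms(2,3)
  define z w where "z = weighted_core_inverse R star m a" and "w = weighted_core_inverse R star m b"
  have ab: "a \<in> carrier R" "b \<in> carrier R"
    using assms(4,5) by (auto simp: weighted_core_invertible_def)
  have zw: "is_weighted_core_inverse R star m a z" "is_weighted_core_inverse R star m b w"
    using is_weighted_core_inverse_weighted_core_inverse[OF m] assms(4,5) by (auto simp: z_def w_def)
  have wc: "w \<in> carrier R" using zw(2) by (simp add: is_weighted_core_inverse_def)
  show ?thesis
    using weighted_core_inverse_eqI[OF m _ core_inverse_mult[OF m ab zw assms(6)]]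
      weighted_core_inverse_eqI[OF m _ core_inverse_mult_projection[OF m ab zw assms(6)]] ab wc
    by (simp flip: z_def w_def)
qed

end
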